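(* For each step size $s>0$, let $\{\mathbf{u}^n\}_{n=0}^\infty\subset U$ be a sequence (which may depend on $s$) with $d_t\mathbf{u}^0=\mathbf{0}$ and $B(\mathbf{u}^0,\mathbf{u}^0)=\mathbf{u}_c$, such that the BDF-$3$ linearized constraint $B(\dot{\mathbf{u}}^n,\hat{\mathbf{u}}^n)=0$ holds for every $n\ge3$, the BDF-$2$ version holds for $n=2$, and the BDF-$1$ version holds for $n=1$. Then there is a constant $C>0$ independent of $s$ and $N$ such that for all $N\ge1$, $$\|B(\mathbf{u}^N,\mathbf{u}^N)-\mathbf{u}_c\|_Z\le C\,s^4\sum_{n=1}^N\|d_t^2\mathbf{u}^n\|_U^2 .$$ Moreover, if there is a constant $c_r>0$ such that $s\sum_{n=1}^N\|d_t^2\mathbf{u}^n\|_U^2\le c_r$ for all $N>0$ and $s>0$, then there is a constant $C'>0$ independent of $s$ and $N$ such that $\|B(\mathbf{u}^N,\mathbf{u}^N)-\mathbf{u}_c\|_Z\le C's^3$.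
   Context: $U$ is a real Hilbert space, $Z$ is a normed function space, $B:U\times U\to Z$ is a symmetric bilinear operator with $\|B(\mathbf{v},\mathbf{v})\|_Z\le c_Z\|\mathbf{v}\|_U^2$ for all $\mathbf{v}\in U$, and $\mathbf{u}_c\in Z$ is given. The BDF-$p$ version of the linearized constraint at index $n$ is $B(\dot{\mathbf{u}}^n,\hat{\mathbf{u}}^n)=0$ with: $p=1$: $\dot{\mathbf{u}}^n=(\mathbf{u}^n-\mathbf{u}^{n-1})/s$, $\hat{\mathbf{u}}^n=\mathbf{u}^{n-1}$; $p=2$: $\dot{\mathbf{u}}^n=\frac1s(\frac32\mathbf{u}^n-2\mathbf{u}^{n-1}+\frac12\mathbf{u}^{n-2})$, $\hat{\mathbf{u}}^n=2\mathbf{u}^{n-1}-\mathbf{u}^{n-2}$; $p=3$: $\dot{\mathbf{u}}^n=\frac1s(\frac{11}6\mathbf{u}^n-3\mathbf{u}^{n-1}+\frac32\mathbf{u}^{n-2}-\frac13\mathbf{u}^{n-3})$, $\hat{\mathbf{u}}^n=3\mathbf{u}^{n-1}-3\mathbf{u}^{n-2}+\mathbf{u}^{n-3}$. Backward differences: $d_t\mathbf{u}^n=(\mathbf{u}^n-\mathbf{u}^{n-1})/s$ for $n\ge1$, $d_t\mathbf{u}^0$ is the prescribed initial velocity, and $d_t^2\mathbf{u}^n=(d_t\mathbf{u}^n-d_t\mathbf{u}^{n-1})/s$ for $n\ge1$. *)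

theory Defs
  imports "HOL-Analysis.Analysis"
begin

text \<open>In the BDF definitions for order \<open>p\<close>, natural subtraction is truncated, so they are meaningful only
  for \<open>n \<ge> p\<close>.\<close>

definition bdf1_dot :: "real \<Rightarrow> (nat \<Rightarrow> 'u::real_vector) \<Rightarrow> nat \<Rightarrow> 'u" where
  "bdf1_dot s u n = (u n - u (n - 1)) /\<^sub>R s"

definition bdf1_hat :: "(nat \<Rightarrow> 'u::real_vector) \<Rightarrow> nat \<Rightarrow> 'u" where
  "bdf1_hat u n = u (n - 1)"

definition bdf2_dot :: "real \<Rightarrow> (nat \<Rightarrow> 'u::real_vector) \<Rightarrow> nat \<Rightarrow> 'u" where
  "bdf2_dot s u n =
     ((3/2) *\<^sub>R u n - 2 *\<^sub>R u (n - 1) + (1/2) *\<^sub>R u (n - 2)) /\<^sub>R s"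

definition bdf2_hat :: "(nat \<Rightarrow> 'u::real_vector) \<Rightarrow> nat \<Rightarrow> 'u" where
  "bdf2_hat u n = 2 *\<^sub>R u (n - 1) - u (n - 2)"

definition bdf3_dot :: "real \<Rightarrow> (nat \<Rightarrow> 'u::real_vector) \<Rightarrow> nat \<Rightarrow> 'u" where
  "bdf3_dot s u n =
     ((11/6) *\<^sub>R u n - 3 *\<^sub>R u (n - 1) + (3/2) *\<^sub>R u (n - 2) - (1/3) *\<^sub>R u (n - 3)) /\<^sub>R s"

definition bdf3_hat :: "(nat \<Rightarrow> 'u::real_vector) \<Rightarrow> nat \<Rightarrow> 'u" where
  "bdf3_hat u n = 3 *\<^sub>R u (n - 1) - 3 *\<^sub>R u (n - 2) + u (n - 3)"

text \<open>The backward difference at index \<open>0\<close> is not determined by the sequence: it is the prescribed initial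
  velocity \<open>v0\<close>.\<close>

definition bdiff :: "real \<Rightarrow> 'u::real_vector \<Rightarrow> (nat \<Rightarrow> 'u) \<Rightarrow> nat \<Rightarrow> 'u" where
  "bdiff s v0 u n = (if n = 0 then v0 else (u n - u (n - 1)) /\<^sub>R s)"

text \<open>Second backward difference; meaningful only for \<open>n \<ge> 1\<close>.\<close>

definition bdiff2 :: "real \<Rightarrow> 'u::real_vector \<Rightarrow> (nat \<Rightarrow> 'u) \<Rightarrow> nat \<Rightarrow> 'u" where
  "bdiff2 s v0 u n = (bdiff s v0 u n - bdiff s v0 u (n - 1)) /\<^sub>R s"

end

theory Submission
  imports Defs
begin

text \<open>
  Write \<open>a\<^sub>n = B(u\<^sup>n, u\<^sup>n)\<close> and let \<open>w\<^sub>n = s\<^sup>2 d\<^sub>t\<^sup>2 u\<^sup>n\<close> be the undivided second difference. Since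
  \<open>\<hat>u\<^sup>n\<close> extrapolates \<open>u\<^sup>n\<close> to third order, the BDF-3 constraint turns into the BDF-3 difference
  scheme for \<open>a\<close> with a remainder in which all products with first differences of \<open>u\<close> cancel: it
  is a quadratic form in \<open>w\<^sub>n\<close> and \<open>w\<^sub>n\<^sub>-\<^sub>1\<close>. For the increments \<open>e\<^sub>n = a\<^sub>n - a\<^sub>n\<^sub>-\<^sub>1\<close> the scheme reads
  \<open>e\<^sub>n = (7/11) e\<^sub>n\<^sub>-\<^sub>1 - (2/11) e\<^sub>n\<^sub>-\<^sub>2 + (6/11) r\<^sub>n\<close>, and because \<open>7/11 + 2/11 < 1\<close> the functional
  \<open>|a\<^sub>n - a\<^sub>0| + (9/2) |e\<^sub>n| + |e\<^sub>n\<^sub>-\<^sub>1|\<close> grows by at most \<open>3 |r\<^sub>n|\<close> in each step. The first two steps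
  behave in the same way.
\<close>

text \<open>Only the diagonal of \<open>B\<close> is controlled by assumption, but the BDF-3
  remainder contains a mixed product. Polarization writes it with two diagonal values, and the
  parallelogram law adds up their bounds.\<close>

lemma bilinear_polarization_bound:
  fixes B :: "'u::real_inner \<Rightarrow> 'u \<Rightarrow> 'z::real_normed_vector"
  assumes bl: "bilinear B" and sym: "\<And>v w. B v w = B w v"
    and bound: "\<And>v. norm (B v v) \<le> c * (norm v)\<^sup>2"
  shows "norm (B v w) \<le> c / 2 * ((norm v)\<^sup>2 + (norm w)\<^sup>2)"
proof -
  have "B (v + w) (v + w) - B (v - w) (v - w) = 2 *\<^sub>R B v w + 2 *\<^sub>R B v w"
    using sym[of w v]
    by (simp add: bilinear_ladd[OF bl] bilinear_lsub[OF bl] bilinear_radd[OF bl] bilinear_rsub[OF bl]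
        scaleR_2)
  then have "4 * norm (B v w) = norm (B (v + w) (v + w) - B (v - w) (v - w))"
    by (simp flip: scaleR_left_distrib)
  also have "\<dots> \<le> c * (norm (v + w))\<^sup>2 + c * (norm (v - w))\<^sup>2"
    using norm_triangle_ineq4 bound by (meson add_mono order_trans)
  also have "\<dots> = c * (2 * (norm v)\<^sup>2 + 2 * (norm w)\<^sup>2)"
    by (simp add: power2_norm_eq_inner inner_simps algebra_simps)
  finally show ?thesis
    by (simp add: algebra_simps)
qed

text \<open>With \<open>d = x - y\<close> and \<open>w\<close> the second difference, the left
  factor is \<open>d + w/2\<close> and the right one is \<open>x - w\<close>. Expanded in
  \<open>x\<close>, \<open>d\<close>, \<open>w\<close>, the two sides agree in every term except
  \<open>B w w\<close>, whose coefficient gives the remainder.\<close>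

lemma bdf2_constraint_identity:
  fixes B :: "'u::real_vector \<Rightarrow> 'u \<Rightarrow> 'z::real_vector"
  assumes bl: "bilinear B" and sym: "\<And>v w. B v w = B w v"
  defines "w \<equiv> \<lambda>x y z. x - 2 *\<^sub>R y + z"
  shows "2 *\<^sub>R B ((3/2) *\<^sub>R x - 2 *\<^sub>R y + (1/2) *\<^sub>R z) (2 *\<^sub>R y - z)
    = (3/2) *\<^sub>R (B x x - B y y) - (1/2) *\<^sub>R (B y y - B z z) - (3/2) *\<^sub>R B (w x y z) (w x y z)"
proof -
  \<comment> \<open>Coordinates for the span of the products, so that the simplifier can compare coefficients.\<close>
  define N where "N a b c d e f = a *\<^sub>R B x x + b *\<^sub>R B x y + c *\<^sub>R B x z
      + d *\<^sub>R B y y + e *\<^sub>R B y z + f *\<^sub>R B z z" for a b c d e f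
  have b: "B x x = N 1 0 0 0 0 0" "B x y = N 0 1 0 0 0 0" "B x z = N 0 0 1 0 0 0"
    "B y y = N 0 0 0 1 0 0" "B y z = N 0 0 0 0 1 0" "B z z = N 0 0 0 0 0 1"
    by (simp_all add: N_def)
  have s: "B y x = B x y" "B z x = B x z" "B z y = B y z"
    using sym by blast+
  have N: "N a b c d e f + N a' b' c' d' e' f' = N (a + a') (b + b') (c + c') (d + d') (e + e') (f + f')"
    "N a b c d e f - N a' b' c' d' e' f' = N (a - a') (b - b') (c - c') (d - d') (e - e') (f - f')"
    "r *\<^sub>R N a b c d e f = N (r * a) (r * b) (r * c) (r * d) (r * e) (r * f)"
    for r a b c d e f a' b' c' d' e' f'
    by (simp_all add: N_def algebra_simps)
  show ?thesis
    by (simp add: w_def bilinear_ladd[OF bl] bilinear_lsub[OF bl] bilinear_radd[OF bl]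
        bilinear_rsub[OF bl] bilinear_lmul[OF bl] bilinear_rmul[OF bl] s b N)
qed

text \<open>With \<open>d = x - y\<close>, \<open>w = w x y z\<close> and
  \<open>w' = w y z t\<close>, the left factor is \<open>d + w/2 + (w - w')/3\<close> and the right
  one is \<open>x - (w - w')\<close>, since the third difference is \<open>w - w'\<close>. The terms
  containing \<open>x\<close> or \<open>d\<close> match on both sides.\<close>

lemma bdf3_constraint_identity:
  fixes B :: "'u::real_vector \<Rightarrow> 'u \<Rightarrow> 'z::real_vector"
  assumes bl: "bilinear B" and sym: "\<And>v w. B v w = B w v"
  defines "w \<equiv> \<lambda>x y z. x - 2 *\<^sub>R y + z"
  shows "2 *\<^sub>R B ((11/6) *\<^sub>R x - 3 *\<^sub>R y + (3/2) *\<^sub>R z - (1/3) *\<^sub>R t) (3 *\<^sub>R y - 3 *\<^sub>R z + t)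
    = (11/6) *\<^sub>R (B x x - B y y) - (7/6) *\<^sub>R (B y y - B z z) + (1/3) *\<^sub>R (B z z - B t t)
    - ((11/6) *\<^sub>R B (w x y z) (w x y z) - (11/3) *\<^sub>R B (w x y z) (w y z t)
       + (1/3) *\<^sub>R B (w y z t) (w y z t))"
proof -
  define N where "N a b c d e f g h i j = a *\<^sub>R B x x + b *\<^sub>R B x y + c *\<^sub>R B x z + d *\<^sub>R B x t
      + e *\<^sub>R B y y + f *\<^sub>R B y z + g *\<^sub>R B y t + h *\<^sub>R B z z + i *\<^sub>R B z t + j *\<^sub>R B t t"
    for a b c d e f g h i j
  have b: "B x x = N 1 0 0 0 0 0 0 0 0 0" "B x y = N 0 1 0 0 0 0 0 0 0 0"
    "B x z = N 0 0 1 0 0 0 0 0 0 0" "B x t = N 0 0 0 1 0 0 0 0 0 0"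
    "B y y = N 0 0 0 0 1 0 0 0 0 0" "B y z = N 0 0 0 0 0 1 0 0 0 0"
    "B y t = N 0 0 0 0 0 0 1 0 0 0" "B z z = N 0 0 0 0 0 0 0 1 0 0"
    "B z t = N 0 0 0 0 0 0 0 0 1 0" "B t t = N 0 0 0 0 0 0 0 0 0 1"
    by (simp_all add: N_def)
  have s: "B y x = B x y" "B z x = B x z" "B t x = B x t" "B z y = B y z" "B t y = B y t" "B t z = B z t"
    using sym by blast+
  have N: "N a b c d e f g h i j + N a' b' c' d' e' f' g' h' i' j'
      = N (a + a') (b + b') (c + c') (d + d') (e + e') (f + f') (g + g') (h + h') (i + i') (j + j')"
    "N a b c d e f g h i j - N a' b' c' d' e' f' g' h' i' j'
      = N (a - a') (b - b') (c - c') (d - d') (e - e') (f - f') (g - g') (h - h') (i - i') (j - j')"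
    "r *\<^sub>R N a b c d e f g h i j
      = N (r * a) (r * b) (r * c) (r * d) (r * e) (r * f) (r * g) (r * h) (r * i) (r * j)"
    for r a b c d e f g h i j a' b' c' d' e' f' g' h' i' j'
    by (simp_all add: N_def algebra_simps)
  show ?thesis
    by (simp add: w_def bilinear_ladd[OF bl] bilinear_lsub[OF bl] bilinear_radd[OF bl]
        bilinear_rsub[OF bl] bilinear_lmul[OF bl] bilinear_rmul[OF bl] s b N)
qed

lemma bdf2_increment_bound:
  fixes B :: "'u::real_inner \<Rightarrow> 'u \<Rightarrow> 'z::real_normed_vector"
  assumes bl: "bilinear B" and sym: "\<And>v w. B v w = B w v"
    and bound: "\<And>v. norm (B v v) \<le> c * (norm v)\<^sup>2"
    and constraint: "B ((3/2) *\<^sub>R x - 2 *\<^sub>R y + (1/2) *\<^sub>R z) (2 *\<^sub>R y - z) = 0"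
  shows "norm (B x x - B y y)
    \<le> 1/3 * norm (B y y - B z z) + c * (norm (x - 2 *\<^sub>R y + z))\<^sup>2"
proof -
  define w where "w = x - 2 *\<^sub>R y + z"
  have "(3/2) *\<^sub>R (B x x - B y y) = (1/2) *\<^sub>R (B y y - B z z) + (3/2) *\<^sub>R B w w"
    using bdf2_constraint_identity[OF bl sym, of x y z] constraint
    by (simp add: w_def add.commute diff_eq_eq)
  then have "norm ((3/2) *\<^sub>R (B x x - B y y))
      \<le> norm ((1/2) *\<^sub>R (B y y - B z z)) + norm ((3/2) *\<^sub>R B w w)"
    by (metis norm_triangle_ineq)
  then show ?thesis
    using bound[of w] by (simp add: w_def)
qed

lemma bdf3_increment_bound:
  fixes B :: "'u::real_inner \<Rightarrow> 'u \<Rightarrow> 'z::real_normed_vector"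
  assumes bl: "bilinear B" and sym: "\<And>v w. B v w = B w v"
    and bound: "\<And>v. norm (B v v) \<le> c * (norm v)\<^sup>2" and "c \<ge> 0"
    and constraint: "B ((11/6) *\<^sub>R x - 3 *\<^sub>R y + (3/2) *\<^sub>R z - (1/3) *\<^sub>R t) (3 *\<^sub>R y - 3 *\<^sub>R z + t) = 0"
  shows "11/6 * norm (B x x - B y y)
    \<le> 7/6 * norm (B y y - B z z) + 1/3 * norm (B z z - B t t)
      + 4 * c * ((norm (x - 2 *\<^sub>R y + z))\<^sup>2 + (norm (y - 2 *\<^sub>R z + t))\<^sup>2)"
proof -
  define w w' where "w = x - 2 *\<^sub>R y + z" and "w' = y - 2 *\<^sub>R z + t"
  define r where "r = (11/6) *\<^sub>R B w w - (11/3) *\<^sub>R B w w' + (1/3) *\<^sub>R B w' w'"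
  have "norm r \<le> 11/6 * norm (B w w) + 11/3 * norm (B w w') + 1/3 * norm (B w' w')"
    unfolding r_def
    using norm_triangle_ineq[of "(11/6) *\<^sub>R B w w - (11/3) *\<^sub>R B w w'" "(1/3) *\<^sub>R B w' w'"]
      norm_triangle_ineq4[of "(11/6) *\<^sub>R B w w" "(11/3) *\<^sub>R B w w'"]
    by simp
  \<comment> \<open>Polarization splits the mixed term into 11/6 for each square, so the
    coefficients are 11/6 + 11/6 and 1/3 + 11/6. Both are then rounded up to 4.\<close>
  also have "\<dots> \<le> 11/3 * (c * (norm w)\<^sup>2) + 13/6 * (c * (norm w')\<^sup>2)"
    using bound[of w] bound[of w'] bilinear_polarization_bound[OF bl sym bound, of w w']
    by (simp add: algebra_simps)
  also have "\<dots> \<le> 4 * (c * (norm w)\<^sup>2) + 4 * (c * (norm w')\<^sup>2)"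
    using \<open>c \<ge> 0\<close> by (intro add_mono mult_right_mono) auto
  finally have r: "norm r \<le> 4 * c * ((norm w)\<^sup>2 + (norm w')\<^sup>2)"
    by (simp add: algebra_simps)
  have eq: "(11/6) *\<^sub>R (B x x - B y y) = (7/6) *\<^sub>R (B y y - B z z) - (1/3) *\<^sub>R (B z z - B t t) + r"
    using bdf3_constraint_identity[OF bl sym, of x y z t] constraint
    unfolding r_def w_def w'_def by (simp add: algebra_simps)
  have "norm ((11/6) *\<^sub>R (B x x - B y y))
      \<le> norm ((7/6) *\<^sub>R (B y y - B z z)) + norm ((1/3) *\<^sub>R (B z z - B t t)) + norm r"
    unfolding eq
    using norm_triangle_ineq[of "(7/6) *\<^sub>R (B y y - B z z) - (1/3) *\<^sub>R (B z z - B t t)" r]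
      norm_triangle_ineq4[of "(7/6) *\<^sub>R (B y y - B z z)" "(1/3) *\<^sub>R (B z z - B t t)"]
    by linarith
  then show ?thesis
    using r by (simp add: w_def w'_def)
qed

text \<open>At index 1 the second difference would reach back to index -1. Zero initial velocity
  acts as a ghost value equal to \<open>u 0\<close>, which leaves a first difference.\<close>

lemma bdiff2_undivided:
  fixes u :: "nat \<Rightarrow> 'u::real_vector"
  assumes "s \<noteq> 0"
  shows "bdiff s v u 0 = 0 \<Longrightarrow> s\<^sup>2 *\<^sub>R bdiff2 s v u 1 = u 1 - u 0"
    and "n \<ge> 2 \<Longrightarrow> s\<^sup>2 *\<^sub>R bdiff2 s v u n = u n - 2 *\<^sub>R u (n - 1) + u (n - 2)"
proof -
  have scale: "s\<^sup>2 *\<^sub>R ((x /\<^sub>R s - y /\<^sub>R s) /\<^sub>R s) = x - y" for x y :: 'u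
  proof -
    have "s\<^sup>2 * (inverse s * inverse s) = 1"
      using assms by (simp add: power2_eq_square field_simps)
    then have "s\<^sup>2 *\<^sub>R ((v /\<^sub>R s) /\<^sub>R s) = v" for v :: 'u
      by simp
    then show ?thesis
      by (simp flip: scaleR_diff_right)
  qed
  show "s\<^sup>2 *\<^sub>R bdiff2 s v u 1 = u 1 - u 0" if "bdiff s v u 0 = 0"
    using scale[of "u 1 - u 0" 0] that by (simp add: bdiff2_def bdiff_def)
  show "s\<^sup>2 *\<^sub>R bdiff2 s v u n = u n - 2 *\<^sub>R u (n - 1) + u (n - 2)" if "n \<ge> 2"
  proof -
    have "n \<noteq> 0" "n - 1 \<noteq> 0" "n - 1 - 1 = n - 2"
      using that by auto
    then have "s\<^sup>2 *\<^sub>R bdiff2 s v u n = (u n - u (n - 1)) - (u (n - 1) - u (n - 2))"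
      using scale by (simp only: bdiff2_def bdiff_def if_False)
    then show ?thesis
      by (simp add: scaleR_2 algebra_simps)
  qed
qed

text \<open>The estimate for one fixed step size. Its factor \<open>24 * c\<close> depends on
  neither \<open>s\<close>, \<open>u\<close> nor \<open>N\<close>, so it serves the whole family of
  sequences.\<close>

lemma bdf3_constraint_drift:
  fixes B :: "'u::real_inner \<Rightarrow> 'u \<Rightarrow> 'z::real_normed_vector"
  assumes bl: "bilinear B" and sym: "\<And>v w. B v w = B w v"
    and bound: "\<And>v. norm (B v v) \<le> c * (norm v)\<^sup>2" and "c \<ge> 0" and "s \<noteq> 0"
    and init: "bdiff s v u 0 = 0"
    and bdf3: "\<And>n. n \<ge> 3 \<Longrightarrow> B (bdf3_dot s u n) (bdf3_hat u n) = 0"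
    and bdf2: "B (bdf2_dot s u 2) (bdf2_hat u 2) = 0"
    and bdf1: "B (bdf1_dot s u 1) (bdf1_hat u 1) = 0"
    and "N \<ge> 1"
  shows "norm (B (u N) (u N) - B (u 0) (u 0))
    \<le> 24 * c * s ^ 4 * (\<Sum>n=1..N. (norm (bdiff2 s v u n))\<^sup>2)"
proof -
  define a where "a n = B (u n) (u n)" for n
  define w where "w n = s\<^sup>2 *\<^sub>R bdiff2 s v u n" for n
  define S where "S n = (\<Sum>k=1..n. c * (norm (w k))\<^sup>2)" for n
  have w1: "w 1 = u 1 - u 0"
    using bdiff2_undivided(1)[OF \<open>s \<noteq> 0\<close> init] by (simp add: w_def)
  have w: "w n = u n - 2 *\<^sub>R u (n - 1) + u (n - 2)" if "n \<ge> 2" for n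
    using bdiff2_undivided(2)[OF \<open>s \<noteq> 0\<close> that] by (simp add: w_def)
  have w_nonneg: "c * (norm (w n))\<^sup>2 \<ge> 0" for n
    using \<open>c \<ge> 0\<close> by simp
  have e1: "norm (a 1 - a 0) \<le> c * (norm (w 1))\<^sup>2"
  proof -
    have "B (u 1 - u 0) (u 0) = 0"
      using bdf1 \<open>s \<noteq> 0\<close> by (simp add: bdf1_dot_def bdf1_hat_def bilinear_lmul[OF bl])
    \<comment> \<open>Expand \<open>a 1\<close> with \<open>u 1 = u 0 + w 1\<close>: the constraint
      removes the cross terms.\<close>
    then have "a 1 - a 0 = B (w 1) (w 1)"
      using sym[of "u 0" "u 1"]
      by (simp only: w1 a_def bilinear_lsub[OF bl] bilinear_rsub[OF bl]) simp
    then show ?thesis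
      using bound by simp
  qed
  have e2: "norm (a 2 - a 1) \<le> 1/3 * norm (a 1 - a 0) + c * (norm (w 2))\<^sup>2"
    using bdf2_increment_bound[OF bl sym bound, of "u 2" "u 1" "u 0"] bdf2 \<open>s \<noteq> 0\<close> w[of 2]
    by (simp add: a_def bdf2_dot_def bdf2_hat_def bilinear_lmul[OF bl])
  have e3: "11/6 * norm (a (Suc n) - a n)
      \<le> 7/6 * norm (a n - a (n - 1)) + 1/3 * norm (a (n - 1) - a (n - 2))
        + 4 * c * ((norm (w (Suc n)))\<^sup>2 + (norm (w n))\<^sup>2)" if "n \<ge> 2" for n
  proof -
    have shift: "Suc n - 1 = n" "Suc n - 2 = n - 1" "Suc n - 3 = n - 2"
      by auto
    have "B ((11/6) *\<^sub>R u (Suc n) - 3 *\<^sub>R u n + (3/2) *\<^sub>R u (n - 1) - (1/3) *\<^sub>R u (n - 2))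
        (3 *\<^sub>R u n - 3 *\<^sub>R u (n - 1) + u (n - 2)) = 0"
      using bdf3[of "Suc n"] that \<open>s \<noteq> 0\<close>
      unfolding bdf3_dot_def bdf3_hat_def shift by (simp add: bilinear_lmul[OF bl])
    from bdf3_increment_bound[OF bl sym bound \<open>c \<ge> 0\<close> this] show ?thesis
      using that w[of "Suc n", unfolded shift] w[of n] by (simp add: a_def)
  qed
  have S_Suc: "S (Suc n) = S n + c * (norm (w (Suc n)))\<^sup>2" for n
    by (simp add: S_def)
  have S1: "S 1 = c * (norm (w 1))\<^sup>2"
    by (simp add: S_def)
  \<comment> \<open>The summand \<open>12 c |w\<^sub>n|\<^sup>2\<close> pays in advance for the share of \<open>w\<^sub>n\<close> in the next remainder.\<close>
  have lyapunov: "norm (a n - a 0) + 9/2 * norm (a n - a (n - 1)) + norm (a (n - 1) - a (n - 2))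
      + 12 * (c * (norm (w n))\<^sup>2) \<le> 24 * S n" if "n \<ge> 2" for n
    using that
  proof (induction n rule: nat_induct_at_least)
    case base
    have "norm (a 2 - a 0) \<le> norm (a 2 - a 1) + norm (a 1 - a 0)"
      using norm_triangle_ineq[of "a 2 - a 1" "a 1 - a 0"] by simp
    \<comment> \<open>By \<open>e1\<close> and \<open>e2\<close> the left side is at most 23/6 times
      \<open>c * (norm (w 1))\<^sup>2\<close> plus 35/2 times
      \<open>c * (norm (w 2))\<^sup>2\<close>; both factors are below 24.\<close>
    then show ?case
      using e1 e2 S_Suc[of 1] S1 w_nonneg[of 1] w_nonneg[of 2]
      by (simp add: numeral_2_eq_2)
  next
    case (Suc n)
    have "norm (a (Suc n) - a 0) \<le> norm (a (Suc n) - a n) + norm (a n - a 0)"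
      using norm_triangle_ineq[of "a (Suc n) - a n" "a n - a 0"] by simp
    moreover have "Suc n - 2 = n - 1" "Suc n - 1 = n"
      using Suc.hyps by auto
    \<comment> \<open>The weights come from three times \<open>e3\<close>: the new increment, now
      with weight 1 + 9/2 = 11/2, costs 7/2 and 1 times the two previous ones. The 7/2 and the 1
      already in the functional restore 9/2. For \<open>w (Suc n)\<close>, the remainder and the
      advance payment of 12 each give 24.\<close>
    ultimately show ?case
      using Suc.IH e3[OF Suc.hyps] S_Suc[of n]
      by (simp add: distrib_left mult.assoc)
  qed
  have "norm (a N - a 0) \<le> 24 * S N"
  proof (cases "N = 1")
    case True
    then show ?thesis
      using e1 S1 w_nonneg[of 1] by simp
  next
    case False
    then have "N \<ge> 2"
      using \<open>N \<ge> 1\<close> by simp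
    from lyapunov[OF this] show ?thesis
      using w_nonneg[of N] norm_ge_zero[of "a N - a (N - 1)"] norm_ge_zero[of "a (N - 1) - a (N - 2)"]
      by linarith
  qed
  \<comment> \<open>The power \<open>s ^ 4\<close> arises from squaring the factor
    \<open>s\<^sup>2\<close> in \<open>w\<close>.\<close>
  then show ?thesis
    by (simp add: a_def S_def w_def power_mult_distrib sum_distrib_left mult.assoc flip: power_mult)
qed

theorem corollary3p6:
  fixes B :: "'u::{real_inner, complete_space} \<Rightarrow> 'u \<Rightarrow> 'z::real_normed_vector"
    and c\<^sub>Z :: real
    and u\<^sub>c :: 'z
    and u :: "real \<Rightarrow> nat \<Rightarrow> 'u"
    and v0 :: "real \<Rightarrow> 'u"
  assumes "bilinear B"
    and "\<And>v w. B v w = B w v"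
    and "\<And>v. norm (B v v) \<le> c\<^sub>Z * (norm v)\<^sup>2"
    and "\<And>s. s > 0 \<Longrightarrow> bdiff s (v0 s) (u s) 0 = 0"
    and "\<And>s. s > 0 \<Longrightarrow> B (u s 0) (u s 0) = u\<^sub>c"
    and "\<And>s n. s > 0 \<Longrightarrow> n \<ge> 3 \<Longrightarrow> B (bdf3_dot s (u s) n) (bdf3_hat (u s) n) = 0"
    and "\<And>s. s > 0 \<Longrightarrow> B (bdf2_dot s (u s) 2) (bdf2_hat (u s) 2) = 0"
    and "\<And>s. s > 0 \<Longrightarrow> B (bdf1_dot s (u s) 1) (bdf1_hat (u s) 1) = 0"
  shows "(\<exists>C>0. \<forall>s>0. \<forall>N\<ge>1.
            norm (B (u s N) (u s N) - u\<^sub>c)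
              \<le> C * s ^ 4 * (\<Sum>n=1..N. (norm (bdiff2 s (v0 s) (u s) n))\<^sup>2)) \<and>
         ((\<exists>c\<^sub>r>0. \<forall>s>0. \<forall>N>0.
             s * (\<Sum>n=1..N. (norm (bdiff2 s (v0 s) (u s) n))\<^sup>2) \<le> c\<^sub>r) \<longrightarrow>
          (\<exists>C'>0. \<forall>s>0. \<forall>N\<ge>1. norm (B (u s N) (u s N) - u\<^sub>c) \<le> C' * s ^ 3))"
proof -
  \<comment> \<open>The sign of \<open>c\<^sub>Z\<close> is not prescribed, while the constants to
    be exhibited must be strictly positive.\<close>
  define c where "c = \<bar>c\<^sub>Z\<bar> + 1"
  let ?D = "\<lambda>s N. \<Sum>n=1..N. (norm (bdiff2 s (v0 s) (u s) n))\<^sup>2"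
  have "c > 0"
    by (simp add: c_def)
  have bound: "norm (B v v) \<le> c * (norm v)\<^sup>2" for v
    using assms(3)[of v] by (rule order_trans) (auto simp: c_def intro: mult_right_mono)
  have drift: "norm (B (u s N) (u s N) - u\<^sub>c) \<le> 24 * c * s ^ 4 * ?D s N" if "s > 0" "N \<ge> 1" for s N
    using bdf3_constraint_drift[of B c s "v0 s" "u s" N] assms bound that \<open>c > 0\<close> by auto
  show ?thesis
  proof (intro conjI impI)
    show "\<exists>C>0. \<forall>s>0. \<forall>N\<ge>1. norm (B (u s N) (u s N) - u\<^sub>c) \<le> C * s ^ 4 * ?D s N"
      using drift \<open>c > 0\<close> by (intro exI[of _ "24 * c"]) auto
  next
    assume "\<exists>c\<^sub>r>0. \<forall>s>0. \<forall>N>0. s * ?D s N \<le> c\<^sub>r"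
    then obtain c\<^sub>r where "c\<^sub>r > 0" and c\<^sub>r: "\<And>s N. s > 0 \<Longrightarrow> N > 0 \<Longrightarrow> s * ?D s N \<le> c\<^sub>r"
      by blast
    have "norm (B (u s N) (u s N) - u\<^sub>c) \<le> 24 * c * c\<^sub>r * s ^ 3" if "s > 0" "N \<ge> 1" for s N
    proof -
      \<comment> \<open>One factor \<open>s\<close> is absorbed into the sum bounded by
        \<open>c\<^sub>r\<close>, leaving third order.\<close>
      have "24 * c * s ^ 4 * ?D s N = 24 * c * s ^ 3 * (s * ?D s N)"
        by (simp add: eval_nat_numeral)
      also have "\<dots> \<le> 24 * c * s ^ 3 * c\<^sub>r"
        using c\<^sub>r[of s N] that \<open>c > 0\<close> by (intro mult_left_mono) auto
      finally show ?thesis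
        using drift[OF that] by (simp add: mult_ac)
    qed
    then show "\<exists>C'>0. \<forall>s>0. \<forall>N\<ge>1. norm (B (u s N) (u s N) - u\<^sub>c) \<le> C' * s ^ 3"
      using \<open>c > 0\<close> \<open>c\<^sub>r > 0\<close> by (intro exI[of _ "24 * c * c\<^sub>r"]) auto
  qed
qed

end
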